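(* Let $N\ge 1$, let $\Sigma\in\mathbb{R}^{N\times N}$ be symmetric positive definite, $\gamma>0$, $\beta>0$, and let $\omega_{t^+}\in\mathbb{R}^N$ satisfy $\iota'\omega_{t^+}=1$. Let $$\omega_{t+1}^*:=\operatorname*{arg\,min}_{\omega\in\mathbb{R}^N,\ \iota'\omega=1}\ \Big\{\frac{\gamma}{2}\omega'\Sigma\omega+\beta\|\omega-\omega_{t^+}\|_1\Big\}.$$ Then this problem is equivalent to a minimum variance problem, in the following sense: there is a subgradient $g^*$ of the function $\omega\mapsto\|\omega-\omega_{t^+}\|_1$ at $\omega=\omega_{t+1}^*$ such that, with $$\Sigma_{\frac{\beta}{\gamma}}:=\Sigma+\frac{\beta}{\gamma}\big(g^*\iota'+\iota g^{*\prime}\big),$$ one has $$\omega_{t+1}^*=\operatorname*{arg\,min}_{\omega\in\mathbb{R}^N,\ \iota'\omega=1}\ \omega'\Sigma_{\frac{\beta}{\gamma}}\,\omega .$$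
   Context: $\iota\in\mathbb{R}^N$ is the vector of ones, a prime denotes transposition, $\|x\|_1=\sum_{i=1}^N|x_i|$. A subgradient of $\omega\mapsto\|\omega-\omega_{t^+}\|_1$ at $\omega^*_{t+1}$ is a vector $g\in\mathbb{R}^N$ with $g_i=1$ if $\omega^*_{t+1,i}>\omega_{t^+,i}$, $g_i=-1$ if $\omega^*_{t+1,i}<\omega_{t^+,i}$, and $g_i\in[-1,1]$ if $\omega^*_{t+1,i}=\omega_{t^+,i}$. Each arg min denotes the unique minimizer. *)

theory Defs
  imports "HOL-Analysis.Analysis"
begin

definition iota :: "real ^ 'n" where
  "iota = (\<chi> i. 1)"

definition l1_norm :: "real ^ 'n \<Rightarrow> real" where
  "l1_norm x = (\<Sum>i\<in>UNIV. \<bar>x $ i\<bar>)"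

definition outer_prod :: "real ^ 'm \<Rightarrow> real ^ 'n \<Rightarrow> real ^ 'n ^ 'm" where
  "outer_prod u v = (\<chi> i j. u $ i * v $ j)"

definition sym_pos_def :: "real ^ 'n ^ 'n \<Rightarrow> bool" where
  "sym_pos_def A \<longleftrightarrow> transpose A = A \<and> (\<forall>x. x \<noteq> 0 \<longrightarrow> x \<bullet> (A *v x) > 0)"

text \<open>\<open>arg_min\<close> picks some minimizer by choice (and an arbitrary element if there is none);
  the following says that a minimizer exists, is unique, and equals \<open>x\<close>.\<close>

definition is_unique_arg_min :: "('a \<Rightarrow> real) \<Rightarrow> ('a \<Rightarrow> bool) \<Rightarrow> 'a \<Rightarrow> bool" where
  "is_unique_arg_min f P x \<longleftrightarrow> is_arg_min f P x \<and> (\<forall>y. is_arg_min f P y \<longrightarrow> y = x)"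

text \<open>\<open>l1_dist_subgradient a w g\<close>: \<open>g\<close> is a subgradient at \<open>w\<close> of the function
  \<open>\<lambda>x. l1_norm (x - a)\<close>.\<close>

definition l1_dist_subgradient :: "real ^ 'n \<Rightarrow> real ^ 'n \<Rightarrow> real ^ 'n \<Rightarrow> bool" where
  "l1_dist_subgradient a w g \<longleftrightarrow>
     (\<forall>i. (w $ i > a $ i \<longrightarrow> g $ i = 1) \<and>
          (w $ i < a $ i \<longrightarrow> g $ i = -1) \<and>
          (w $ i = a $ i \<longrightarrow> g $ i \<in> {-1..1}))"

definition fully_invested :: "real ^ 'n \<Rightarrow> bool" where
  "fully_invested w \<longleftrightarrow> iota \<bullet> w = 1"

definition cost_objective ::
  "real ^ 'n ^ 'n \<Rightarrow> real \<Rightarrow> real \<Rightarrow> real ^ 'n \<Rightarrow> real ^ 'n \<Rightarrow> real" where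
  "cost_objective \<Sigma> \<gamma> \<beta> a w = \<gamma> / 2 * (w \<bullet> (\<Sigma> *v w)) + \<beta> * l1_norm (w - a)"

definition adjusted_cov ::
  "real ^ 'n ^ 'n \<Rightarrow> real \<Rightarrow> real \<Rightarrow> real ^ 'n \<Rightarrow> real ^ 'n ^ 'n" where
  "adjusted_cov \<Sigma> \<gamma> \<beta> g = \<Sigma> + (\<beta> / \<gamma>) *\<^sub>R (outer_prod g iota + outer_prod iota g)"

end

theory Submission
  imports Defs
begin

text \<open>Write \<open>c = \<gamma> \<Sigma> \<omega>'\<close>. Moving from the minimizer \<open>\<omega>'\<close> in the feasible direction
  \<open>e\<^sub>i - e\<^sub>j\<close> cannot decrease the cost, so \<open>c\<^sub>j + \<beta> l\<^sub>j \<le> c\<^sub>i + \<beta> r\<^sub>i\<close> for all \<open>i\<close> and \<open>j\<close>, where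
  \<open>l\<^sub>j\<close> and \<open>r\<^sub>i\<close> are the left and right derivatives of the absolute value at the respective
  coordinates of \<open>\<omega>' - \<omega>\<^sub>0\<close>. A number \<open>\<lambda>\<close> separating the two families is a Lagrange multiplier:
  \<open>g = (\<lambda> \<iota> - c) / \<beta>\<close> is a subgradient with \<open>c + \<beta> g = \<lambda> \<iota>\<close>. By positive definiteness, this
  stationarity makes \<open>\<omega>'\<close> the unique minimizer of
  \<open>\<gamma>/2 \<omega> \<bullet> \<Sigma>\<omega> + \<beta> g \<bullet> \<omega>\<close> on the hyperplane \<open>\<iota> \<bullet> \<omega> = 1\<close>. There this function is
  \<open>\<gamma>/2\<close> times the adjusted quadratic form, and up to an additive constant it minorizes the
  cost with equality at \<open>\<omega>'\<close>.\<close>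

lemma quadratic_form_add:
  fixes A :: "real ^ 'n ^ 'n"
  assumes "transpose A = A"
  shows "(x + d) \<bullet> (A *v (x + d)) = x \<bullet> (A *v x) + 2 * (d \<bullet> (A *v x)) + d \<bullet> (A *v d)"
proof -
  have "x \<bullet> (A *v d) = d \<bullet> (A *v x)"
    using dot_lmul_matrix[of x A d] assms
    by (metis inner_commute transpose_matrix_vector)
  then show ?thesis
    by (simp add: matrix_vector_right_distrib inner_add_left inner_add_right)
qed

lemma outer_prod_mult_vector: "outer_prod u v *v w = (v \<bullet> w) *\<^sub>R u"
  by (simp add: outer_prod_def matrix_vector_mult_def vec_eq_iff inner_vec_def
      sum_distrib_left sum_distrib_right mult_ac)

lemma adjusted_cov_quadratic_form:
  "w \<bullet> (adjusted_cov \<Sigma> \<gamma> \<beta> g *v w) =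
    w \<bullet> (\<Sigma> *v w) + 2 * (\<beta> / \<gamma>) * (g \<bullet> w) * (iota \<bullet> w)"
  unfolding adjusted_cov_def
  by (simp add: matrix_vector_mult_add_rdistrib scaleR_matrix_vector_assoc [symmetric]
      outer_prod_mult_vector inner_add_right inner_commute algebra_simps)

lemma is_unique_arg_minI:
  assumes "P x" and "\<And>y. P y \<Longrightarrow> y \<noteq> x \<Longrightarrow> f x < f y"
  shows "is_unique_arg_min f P x"
  using assms unfolding is_unique_arg_min_def is_arg_min_def by (metis order.asym order.irrefl)

text \<open>Convexity of the absolute value in each coordinate: the line of slope
  \<open>g $ i\<close> through the graph at \<open>x $ i - a $ i\<close> stays below the
  graph.\<close>

lemma l1_dist_subgradient_inequality:
  assumes "l1_dist_subgradient a x g"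
  shows "l1_norm (x - a) + g \<bullet> (y - x) \<le> l1_norm (y - a)"
proof -
  have "\<bar>x $ i - a $ i\<bar> + g $ i * (y $ i - x $ i) \<le> \<bar>y $ i - a $ i\<bar>" for i
  proof (cases "x $ i" "a $ i" rule: linorder_cases)
    case equal
    then have "\<bar>g $ i\<bar> \<le> 1"
      using assms by (auto simp: l1_dist_subgradient_def abs_le_iff)
    then have "\<bar>g $ i * (y $ i - a $ i)\<bar> \<le> 1 * \<bar>y $ i - a $ i\<bar>"
      unfolding abs_mult by (intro mult_right_mono) auto
    then show ?thesis using equal by simp
  qed (use assms in \<open>auto simp: l1_dist_subgradient_def\<close>)
  then show ?thesis
    by (simp add: l1_norm_def inner_vec_def sum.distrib [symmetric] sum_mono)
qed

text \<open>To the right of any point the absolute value is affine at first, so its one-sided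
  derivative enters as an exact identity for small \<open>t\<close>. At the kink the right slope is
  1.\<close>

lemma abs_add_eventually_at_right:
  fixes x :: real
  shows "\<forall>\<^sub>F t in at_right 0. \<bar>x + t\<bar> = \<bar>x\<bar> + t * (if x \<ge> 0 then 1 else -1)"
proof (cases "x \<ge> 0")
  case True
  show ?thesis
    using eventually_at_right_less[of 0] by eventually_elim (use True in auto)
next
  case False
  then have "\<forall>\<^sub>F t in at_right 0. t \<in> {0<..< - x}"
    by (intro eventually_at_right_real) auto
  then show ?thesis by eventually_elim (use False in auto)
qed

lemma abs_diff_eventually_at_right:
  fixes x :: real
  shows "\<forall>\<^sub>F t in at_right 0. \<bar>x - t\<bar> = \<bar>x\<bar> - t * (if x > 0 then 1 else -1)"
  \<comment> \<open>Reflection at 0 turns right slopes into left slopes, so the kink now falls under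
    slope -1.\<close>
  using abs_add_eventually_at_right[of "- x"] by eventually_elim (auto split: if_splits)

lemma l1_norm_transfer_eventually:
  fixes x :: "real ^ 'n"
  assumes "i \<noteq> j"
  shows "\<forall>\<^sub>F t in at_right 0. l1_norm (x + t *\<^sub>R (axis i 1 - axis j 1)) =
    l1_norm x + t * ((if x $ i \<ge> 0 then 1 else -1) - (if x $ j > 0 then 1 else -1))"
  using abs_add_eventually_at_right[of "x $ i"] abs_diff_eventually_at_right[of "x $ j"]
proof eventually_elim
  case (elim t)
  let ?y = "x + t *\<^sub>R (axis i 1 - axis j 1)"
  have "l1_norm ?y - l1_norm x = (\<Sum>k\<in>UNIV. \<bar>?y $ k\<bar> - \<bar>x $ k\<bar>)"
    by (simp add: l1_norm_def sum_subtractf)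
  also have "\<dots> = (\<Sum>k\<in>{i, j}. \<bar>?y $ k\<bar> - \<bar>x $ k\<bar>)"
    by (rule sum.mono_neutral_right) (auto simp: axis_def)
  also have "\<dots> = \<bar>x $ i + t\<bar> - \<bar>x $ i\<bar> + (\<bar>x $ j - t\<bar> - \<bar>x $ j\<bar>)"
    using assms by (simp add: axis_def)
  finally show ?case using elim by (simp add: algebra_simps)
qed

text \<open>First-order optimality: along a direction orthogonal to \<open>iota\<close>, the cost
  changes by \<open>t * (q + t * K)\<close> for small \<open>t > 0\<close>. Minimality makes the
  second factor nonnegative, and letting \<open>t\<close> tend to 0 leaves
  \<open>0 \<le> q\<close>.\<close>

lemma is_arg_min_transfer:
  fixes \<Sigma> :: "real ^ 'n ^ 'n"
  assumes sym: "transpose \<Sigma> = \<Sigma>" and "\<beta> > 0"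
    and min: "is_arg_min (cost_objective \<Sigma> \<gamma> \<beta> a) fully_invested w"
  shows "\<gamma> * (\<Sigma> *v w) $ j + \<beta> * (if w $ j > a $ j then 1 else -1)
    \<le> \<gamma> * (\<Sigma> *v w) $ i + \<beta> * (if w $ i \<ge> a $ i then 1 else -1)"
proof (cases "i = j")
  \<comment> \<open>The direction vanishes here, and the claim says only that the left slope is at
    most the right slope.\<close>
  case True
  then show ?thesis using \<open>\<beta> > 0\<close> by auto
next
  case False
  define d :: "real ^ 'n" where "d = axis i 1 - axis j 1"
  define s :: real where
    "s = (if w $ i \<ge> a $ i then 1 else -1) - (if w $ j > a $ j then 1 else -1)"
  define q where "q = \<gamma> * (d \<bullet> (\<Sigma> *v w)) + \<beta> * s"
  define K where "K = \<gamma> / 2 * (d \<bullet> (\<Sigma> *v d))"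
  have "\<forall>\<^sub>F t in at_right 0. 0 \<le> q + t * K"
    using l1_norm_transfer_eventually[OF False, of "w - a"] eventually_at_right_less[of 0]
  proof eventually_elim
    case (elim t)
    have l1: "l1_norm (w + t *\<^sub>R d - a) = l1_norm (w - a) + t * s"
      using elim(1) by (simp add: d_def s_def add_diff_eq diff_add_eq)
    have "iota \<bullet> d = 0"
      by (simp add: d_def iota_def inner_diff_right inner_axis)
    then have "fully_invested (w + t *\<^sub>R d)"
      using min by (simp add: is_arg_min_def fully_invested_def inner_add_right)
    then have "cost_objective \<Sigma> \<gamma> \<beta> a w \<le> cost_objective \<Sigma> \<gamma> \<beta> a (w + t *\<^sub>R d)"
      using min by (meson is_arg_min_def not_less)
    also have "cost_objective \<Sigma> \<gamma> \<beta> a (w + t *\<^sub>R d) = cost_objective \<Sigma> \<gamma> \<beta> a w + t * (q + t * K)"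
      unfolding cost_objective_def quadratic_form_add[OF sym] l1
      by (simp add: q_def K_def matrix_vector_mult_scaleR field_simps)
    finally show ?case using elim(2) by (simp add: zero_le_mult_iff)
  qed
  moreover have "((\<lambda>t. q + t * K) \<longlongrightarrow> q + 0 * K) (at_right 0)"
    by (intro tendsto_intros)
  ultimately have "0 \<le> q"
    using tendsto_lowerbound[of "\<lambda>t. q + t * K" q "at_right 0" 0] by simp
  then show ?thesis
    by (simp add: q_def s_def d_def inner_diff_left inner_axis' algebra_simps)
qed

lemma stationary_subgradient_exists:
  fixes \<Sigma> :: "real ^ 'n ^ 'n"
  assumes "transpose \<Sigma> = \<Sigma>" and "\<beta> > 0"
    and "is_arg_min (cost_objective \<Sigma> \<gamma> \<beta> a) fully_invested w"
  obtains g \<mu> where "l1_dist_subgradient a w g" and "\<gamma> *\<^sub>R (\<Sigma> *v w) + \<beta> *\<^sub>R g = \<mu> *\<^sub>R iota"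
proof -
  define c where "c = (\<lambda>i. \<gamma> * (\<Sigma> *v w) $ i)"
  define l r :: "'n \<Rightarrow> real" where "l = (\<lambda>i. if w $ i > a $ i then 1 else -1)"
    and "r = (\<lambda>i. if w $ i \<ge> a $ i then 1 else -1)"
  \<comment> \<open>The largest lower bound serves as the multiplier; it stays below every upper
    bound because each lower bound does.\<close>
  define \<mu> where "\<mu> = Max (range (\<lambda>j. c j + \<beta> * l j))"
  define g :: "real ^ 'n" where "g = (\<chi> i. (\<mu> - c i) / \<beta>)"
  have "c i + \<beta> * l i \<le> \<mu>" for i
    unfolding \<mu>_def by (intro Max_ge) auto
  moreover have "\<mu> \<le> c i + \<beta> * r i" for i
    using is_arg_min_transfer[OF assms] unfolding \<mu>_def c_def l_def r_def
    by (subst Max_le_iff) auto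
  ultimately have "l i \<le> g $ i \<and> g $ i \<le> r i" for i
    using \<open>\<beta> > 0\<close> by (simp add: g_def field_simps add.commute)
  \<comment> \<open>Away from the kink \<open>l i = r i\<close> forces the sign; at the kink the
    bounds are -1 and 1.\<close>
  then have "l1_dist_subgradient a w g"
    unfolding l1_dist_subgradient_def l_def r_def
    by (smt (verit) atLeastAtMost_iff)
  moreover have "\<gamma> *\<^sub>R (\<Sigma> *v w) + \<beta> *\<^sub>R g = \<mu> *\<^sub>R iota"
    using \<open>\<beta> > 0\<close> by (simp add: vec_eq_iff g_def c_def iota_def)
  ultimately show ?thesis using that by blast
qed

text \<open>The difference \<open>d = y - w\<close> is orthogonal to \<open>iota\<close>, so
  stationarity cancels the terms linear in \<open>d\<close>. What remains is
  \<open>\<gamma> / 2 * (d \<bullet> (\<Sigma> *v d))\<close>, which is positive.\<close>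

lemma stationary_strict_minimum:
  fixes \<Sigma> :: "real ^ 'n ^ 'n"
  assumes "sym_pos_def \<Sigma>" and "\<gamma> > 0"
    and stat: "\<gamma> *\<^sub>R (\<Sigma> *v w) + \<beta> *\<^sub>R g = \<mu> *\<^sub>R iota"
    and "fully_invested w" and "fully_invested y" and "y \<noteq> w"
  shows "\<gamma> / 2 * (w \<bullet> (\<Sigma> *v w)) + \<beta> * (g \<bullet> w) < \<gamma> / 2 * (y \<bullet> (\<Sigma> *v y)) + \<beta> * (g \<bullet> y)"
proof -
  define d where "d = y - w"
  have y: "y = w + d" and "d \<noteq> 0"
    using \<open>y \<noteq> w\<close> by (auto simp: d_def)
  have "d \<bullet> (\<gamma> *\<^sub>R (\<Sigma> *v w) + \<beta> *\<^sub>R g) = 0"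
    unfolding stat using assms(4,5)
    by (simp add: d_def fully_invested_def inner_diff_right inner_commute[of _ iota])
  then have "\<gamma> * (d \<bullet> (\<Sigma> *v w)) + \<beta> * (g \<bullet> d) = 0"
    by (simp add: inner_add_right inner_commute)
  moreover have "\<gamma> * (d \<bullet> (\<Sigma> *v d)) > 0"
    using assms(1,2) \<open>d \<noteq> 0\<close> by (simp add: sym_pos_def_def)
  moreover have sym: "transpose \<Sigma> = \<Sigma>"
    using assms(1) by (simp add: sym_pos_def_def)
  ultimately show ?thesis
    unfolding y quadratic_form_add[OF sym] inner_add_right[of g]
    by (simp add: algebra_simps)
qed

text \<open>The sublevel set of the feasible point \<open>a\<close> is compact: the quadratic part
  is nonnegative, so the cost bounds the distance from \<open>a\<close> through the l1 term.\<close>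

lemma cost_objective_arg_min_exists:
  fixes \<Sigma> :: "real ^ 'n ^ 'n"
  assumes "sym_pos_def \<Sigma>" and "\<gamma> > 0" and "\<beta> > 0" and "fully_invested a"
  shows "\<exists>w. is_arg_min (cost_objective \<Sigma> \<gamma> \<beta> a) fully_invested w"
proof -
  let ?f = "cost_objective \<Sigma> \<gamma> \<beta> a"
  define S where "S = {w. fully_invested w} \<inter> {w. ?f w \<le> ?f a}"
  have cont: "continuous_on UNIV ?f"
    unfolding cost_objective_def l1_norm_def
    by (intro continuous_intros linear_continuous_on_compose[OF continuous_on_id matrix_vector_mul_linear])
  have "S \<subseteq> cball a (?f a / \<beta>)"
  proof
    fix w assume "w \<in> S"
    have "0 \<le> w \<bullet> (\<Sigma> *v w)"
      using assms(1) by (cases "w = 0") (auto simp: sym_pos_def_def less_imp_le)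
    then have "\<beta> * l1_norm (w - a) \<le> ?f w"
      using \<open>\<gamma> > 0\<close> by (simp add: cost_objective_def)
    moreover have "?f w \<le> ?f a"
      using \<open>w \<in> S\<close> by (simp add: S_def)
    ultimately have "l1_norm (w - a) \<le> ?f a / \<beta>"
      using \<open>\<beta> > 0\<close> by (simp add: field_simps)
    moreover have "norm (w - a) \<le> l1_norm (w - a)"
      using norm_le_l1_cart[of "w - a"] by (simp add: l1_norm_def)
    ultimately show "w \<in> cball a (?f a / \<beta>)"
      by (simp add: dist_norm norm_minus_commute)
  qed
  then have "bounded S"
    by (rule bounded_subset[OF bounded_cball])
  moreover have "closed S"
    unfolding S_def fully_invested_def
    by (intro closed_Int closed_Collect_eq closed_Collect_le continuous_intros cont)
  ultimately have "compact S"
    by (simp add: compact_eq_bounded_closed)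
  moreover have "a \<in> S"
    using assms(4) by (simp add: S_def)
  ultimately obtain w where "w \<in> S" and w: "\<And>y. y \<in> S \<Longrightarrow> ?f w \<le> ?f y"
    using continuous_attains_inf[of S ?f] continuous_on_subset[OF cont] by blast
  \<comment> \<open>A feasible \<open>y\<close> outside \<open>S\<close> costs more than
    \<open>a\<close>, hence more than \<open>w\<close>.\<close>
  have "\<not> ?f y < ?f w" if "fully_invested y" for y
    using w[of y] w[OF \<open>a \<in> S\<close>] that by (force simp: S_def)
  then show ?thesis
    using \<open>w \<in> S\<close> by (auto simp: is_arg_min_def S_def)
qed

theorem proposition5:
  fixes \<Sigma> :: "real ^ 'n ^ 'n" and \<gamma> \<beta> :: real and \<omega>\<^sub>0 \<omega>' :: "real ^ 'n"
  assumes "sym_pos_def \<Sigma>"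
    and "\<gamma> > 0" and "\<beta> > 0"
    and "iota \<bullet> \<omega>\<^sub>0 = 1"
    and "\<omega>' = arg_min (cost_objective \<Sigma> \<gamma> \<beta> \<omega>\<^sub>0) fully_invested"
  shows "is_unique_arg_min (cost_objective \<Sigma> \<gamma> \<beta> \<omega>\<^sub>0) fully_invested \<omega>' \<and>
    (\<exists>g. l1_dist_subgradient \<omega>\<^sub>0 \<omega>' g \<and>
      is_unique_arg_min (\<lambda>\<omega>. \<omega> \<bullet> (adjusted_cov \<Sigma> \<gamma> \<beta> g *v \<omega>)) fully_invested \<omega>')"
proof -
  have "\<exists>w. is_arg_min (cost_objective \<Sigma> \<gamma> \<beta> \<omega>\<^sub>0) fully_invested w"
    using assms(1-4) by (intro cost_objective_arg_min_exists) (simp_all add: fully_invested_def)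
  then have min: "is_arg_min (cost_objective \<Sigma> \<gamma> \<beta> \<omega>\<^sub>0) fully_invested \<omega>'"
    unfolding assms(5) arg_min_def by (rule someI_ex)
  then have fi: "fully_invested \<omega>'"
    by (simp add: is_arg_min_def)
  have "transpose \<Sigma> = \<Sigma>"
    using assms(1) by (simp add: sym_pos_def_def)
  then obtain g \<mu> where g: "l1_dist_subgradient \<omega>\<^sub>0 \<omega>' g"
    and stat: "\<gamma> *\<^sub>R (\<Sigma> *v \<omega>') + \<beta> *\<^sub>R g = \<mu> *\<^sub>R iota"
    using stationary_subgradient_exists[OF _ assms(3) min] by blast
  note less = stationary_strict_minimum[OF assms(1,2) stat fi]
  have "is_unique_arg_min (cost_objective \<Sigma> \<gamma> \<beta> \<omega>\<^sub>0) fully_invested \<omega>'"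
  proof (rule is_unique_arg_minI[where P = fully_invested, OF fi])
    fix y :: "real ^ 'n" assume "fully_invested y" and "y \<noteq> \<omega>'"
    moreover have "\<beta> * (l1_norm (\<omega>' - \<omega>\<^sub>0) + g \<bullet> (y - \<omega>')) \<le> \<beta> * l1_norm (y - \<omega>\<^sub>0)"
      using l1_dist_subgradient_inequality[OF g, of y] assms(3) by simp
    ultimately show "cost_objective \<Sigma> \<gamma> \<beta> \<omega>\<^sub>0 \<omega>' < cost_objective \<Sigma> \<gamma> \<beta> \<omega>\<^sub>0 y"
      using less[of y] by (simp add: cost_objective_def inner_diff_right algebra_simps)
  qed
  moreover have "is_unique_arg_min (\<lambda>\<omega>. \<omega> \<bullet> (adjusted_cov \<Sigma> \<gamma> \<beta> g *v \<omega>)) fully_invested \<omega>'"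
  proof (rule is_unique_arg_minI[where P = fully_invested, OF fi])
    fix y :: "real ^ 'n" assume y: "fully_invested y" and "y \<noteq> \<omega>'"
    \<comment> \<open>With \<open>iota \<bullet> w = 1\<close> the rank-two correction becomes
      linear in \<open>w\<close>.\<close>
    have form: "w \<bullet> (adjusted_cov \<Sigma> \<gamma> \<beta> g *v w) =
        2 / \<gamma> * (\<gamma> / 2 * (w \<bullet> (\<Sigma> *v w)) + \<beta> * (g \<bullet> w))"
      if "fully_invested w" for w :: "real ^ 'n"
      using that assms(2)
      by (simp add: adjusted_cov_quadratic_form fully_invested_def field_simps)
    show "\<omega>' \<bullet> (adjusted_cov \<Sigma> \<gamma> \<beta> g *v \<omega>') < y \<bullet> (adjusted_cov \<Sigma> \<gamma> \<beta> g *v y)"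
      unfolding form[OF fi] form[OF y]
      using less[OF y \<open>y \<noteq> \<omega>'\<close>] assms(2) by (intro mult_strict_left_mono) auto
  qed
  ultimately show ?thesis using g by blast
qed

end
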